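(* If $E(\lambda)$ is a $\top$-anti-palindromic $n\times n$ matrix pencil with $\operatorname{rank}E=r\leq n$, then it can be written as $$E(\lambda)=\begin{cases}v_1w_1^\top+\cdots+v_sw_s^\top-(\operatorname{rev}w_1)v_1^\top-\cdots-(\operatorname{rev}w_s)v_s^\top,&\text{if } r \text{ is even},\\ (1-\lambda)uu^\top+v_1w_1^\top+\cdots+v_sw_s^\top-(\operatorname{rev}w_1)v_1^\top-\cdots-(\operatorname{rev}w_s)v_s^\top,&\text{if } r \text{ is odd},\end{cases}$$ where $u,v_j,w_j\in\mathbb C[\lambda]^n$, $s=\lfloor r/2\rfloor$, $\deg u=\deg v_1=\cdots=\deg v_s=0$, and $\deg w_1,\dots,\deg w_s\leq 1$.
   Context: A matrix pencil $E(\lambda)=A+\lambda B$ with $A,B\in\mathbb C^{n\times n}$ is $\top$-anti-palindromic if $A^\top=-B$. Its rank is the normal rank, i.e. the rank as a matrix over the field of rational functions, $\max_{\lambda\in\mathbb C}\operatorname{rank}(A+\lambda B)$. For $v(\lambda)\in\mathbb C[\lambda]^n$, $\deg v$ is the largest degree of the entries of $v$; so $\deg v=0$ means that $v$ is a constant vector in $\mathbb C^n$. For $w(\lambda)=w_0+\lambda w_1$ with $w_0,w_1\in\mathbb C^n$, $\operatorname{rev}w(\lambda)=w_1+\lambda w_0$. *)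

theory Defs
  imports "HOL-Analysis.Analysis" "HOL-Computational_Algebra.Polynomial"
begin

text \<open>The entry in position (i, j) of a matrix \<open>M\<close> is \<open>M $ i $ j\<close>. Elements of the
  module of polynomial vectors are of type \<^typ>\<open>complex poly ^ 'n\<close>, and matrix pencils are
  polynomial matrices of type \<^typ>\<open>complex poly ^ 'n ^ 'n\<close>.\<close>

definition pencil :: "complex ^ 'n ^ 'n \<Rightarrow> complex ^ 'n ^ 'n \<Rightarrow> complex poly ^ 'n ^ 'n" where
  "pencil A B = (\<chi> i j. [:A $ i $ j, B $ i $ j:])"

definition anti_palindromic :: "complex poly ^ 'n ^ 'n \<Rightarrow> bool" where
  "anti_palindromic E \<longleftrightarrow> (\<exists>A B. E = pencil A B \<and> transpose A = - B)"

definition eval_mat :: "complex poly ^ 'n ^ 'm \<Rightarrow> complex \<Rightarrow> complex ^ 'n ^ 'm" where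
  "eval_mat E z = (\<chi> i j. poly (E $ i $ j) z)"

definition normal_rank :: "complex poly ^ 'n ^ 'm \<Rightarrow> nat" where
  "normal_rank E = Max (range (\<lambda>z. rank (eval_mat E z)))"

text \<open>The maximum is taken over a finite nonempty set, so it is attained.\<close>

lemma rank_le_card_columns:
  fixes M :: "'a::field ^ 'n ^ 'm"
  shows "rank M \<le> CARD('n)"
  unfolding row_rank_def_gen
  by (metis subset_UNIV vec.dim_subset vec_dim_card)

lemma finite_ranks:
  fixes E :: "complex poly ^ 'n ^ 'm"
  shows "finite (range (\<lambda>z. rank (eval_mat E z)))"
  by (rule finite_subset[of _ "{..CARD('n)}"]) (auto simp: rank_le_card_columns)

text \<open>The degree of the zero vector is 0, in accordance with the degree of the zero polynomial;
  thus \<open>deg_vec v = 0\<close> holds exactly for the constant vectors.\<close>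

definition deg_vec :: "complex poly ^ 'n \<Rightarrow> nat" where
  "deg_vec v = Max (range (\<lambda>i. degree (v $ i)))"

text \<open>The reversal is taken with respect to grade 1: \<open>w\<^sub>0 + \<lambda> w\<^sub>1\<close> is mapped to
  \<open>w\<^sub>1 + \<lambda> w\<^sub>0\<close> also if \<open>w\<^sub>1 = 0\<close>, unlike for the function \<^const>\<open>reflect_poly\<close>, which depends on the
  degree. It is only meaningful for vectors of degree at most 1.\<close>

definition rev_vec :: "complex poly ^ 'n \<Rightarrow> complex poly ^ 'n" where
  "rev_vec w = (\<chi> i. [:coeff (w $ i) 1, coeff (w $ i) 0:])"

text \<open>The product of a column and a row.\<close>

definition outer :: "'a::times ^ 'm \<Rightarrow> 'a ^ 'n \<Rightarrow> 'a ^ 'n ^ 'm" where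
  "outer v w = (\<chi> i j. v $ i * w $ j)"

definition smult_mat :: "'a::times \<Rightarrow> 'a ^ 'n ^ 'm \<Rightarrow> 'a ^ 'n ^ 'm" where
  "smult_mat c M = (\<chi> i j. c * M $ i $ j)"

lemma eval_mat_pencil: "eval_mat (pencil A B) z = A + smult_mat z B"
  by (simp add: eval_mat_def pencil_def smult_mat_def vec_eq_iff)

lemma deg_vec_eq_0_iff: "deg_vec v = 0 \<longleftrightarrow> (\<exists>c. v = (\<chi> i. [:c $ i:]))"
proof
  assume "deg_vec v = 0"
  then have "degree (v $ i) = 0" for i
    unfolding deg_vec_def by (metis Max_ge finite_class.finite_UNIV finite_imageI le_zero_eq rangeI)
  then have "v = (\<chi> i. [:(\<chi> i. coeff (v $ i) 0) $ i:])"
    by (auto simp: vec_eq_iff degree_0_id[symmetric] intro!: degree_eq_zeroE poly_eqI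
        simp: coeff_pCons coeff_eq_0 split: nat.split)
  then show "\<exists>c. v = (\<chi> i. [:c $ i:])" by blast
qed (auto simp: deg_vec_def)

lemma rev_vec_linear:
  "rev_vec (\<chi> i. [:w0 $ i, w1 $ i:]) = (\<chi> i. [:w1 $ i, w0 $ i:])"
  by (simp add: rev_vec_def)

end

theory Submission
  imports Defs "HOL-Computational_Algebra.Fundamental_Theorem_Algebra"
begin

text \<open>
  Write \<open>E(\<lambda>) = A - \<lambda> A\<^sup>T\<close> and \<open>w\<^sub>j = a\<^sub>j + \<lambda> b\<^sub>j\<close>. On both sides of the representation of \<open>E\<close>, the
  coefficient of \<open>\<lambda>\<close> is minus the transpose of the constant term, so the representation amounts to
  \<open>A = [u u\<^sup>T] + \<Sum>\<^sub>j (v\<^sub>j a\<^sub>j\<^sup>T - b\<^sub>j v\<^sub>j\<^sup>T)\<close>, with \<open>\<lfloor>r / 2\<rfloor>\<close> terms in the sum and with \<open>u u\<^sup>T\<close> only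
  for odd \<open>r\<close>. So the theorem is about the bilinear form \<open>x\<^sup>T A y\<close>: after the restriction to
  the hyperplane \<open>v\<^sub>j = 0\<close>, the \<open>j\<close>-th term disappears. Conversely, two forms that agree on the
  hyperplane \<open>\<theta> = 0\<close> differ by a term \<open>\<theta> a\<^sup>T - b \<theta>\<^sup>T\<close>
  (\<open>split_form_extend_hyperplane\<close>). It suffices to find hyperplanes for which
  the restriction lowers the rank of the pencil by 2.

  This is done by induction on the dimension of a subspace \<open>U\<close> carrying the form. If \<open>dim U \<ge> 2\<close>, there is an eigenvector of the pencil in \<open>U\<close>, that is,
  a vector \<open>x \<noteq> 0\<close> for which the functionals \<open>A(x,-)\<close> and \<open>A(-,x)\<close> on \<open>U\<close> are proportional, say equal to
  \<open>p \<theta>\<close> and \<open>q \<theta>\<close> with \<open>(p,q) \<noteq> (0,0)\<close>; and it can be taken isotropic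
  (\<open>isotropic_pencil_eigenvector\<close>). There are two cases.

  \<^item> If \<open>\<theta>\<close> vanishes on \<open>U\<close>, then \<open>x\<close> is in both radicals, and it can be split off without changing the
    rank (\<open>split_form_extend_radical\<close>).
  \<^item> Otherwise, \<open>U\<close> is replaced by its hyperplane \<open>\<theta> = 0\<close>, which contains \<open>x\<close>.
    For all but at most two \<open>\<lambda>\<close>, the kernel of the pencil on \<open>U\<close> lies in this hyperplane and does not
    contain \<open>x\<close>, while the kernel of the restricted pencil contains both (\<open>pencil_kernel_grows\<close>).
    The dimension drops by one and the nullity increases by at least one, so the rank drops by at least 2.

  In dimension at most 1, the form is zero or a square \<open>u u\<^sup>T\<close>, because complex numbers have square
  roots. The induction is carried out in \<open>split_form_exists\<close>.
\<close>

section \<open>Bilinear forms and hyperplanes\<close>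

definition dot :: "'a::comm_semiring_1 ^ 'n \<Rightarrow> 'a ^ 'n \<Rightarrow> 'a" where
  "dot x y = (\<Sum>i\<in>UNIV. x $ i * y $ i)"

definition form :: "'a::field ^ 'n ^ 'm \<Rightarrow> 'a ^ 'm \<Rightarrow> 'a ^ 'n \<Rightarrow> 'a" where
  "form A x y = dot x (A *v y)"

lemma dot_commute: "dot x y = dot y x"
  by (simp add: dot_def mult.commute)

lemma dot_add_right: "dot x (y + z) = dot x y + dot x z"
  and dot_add_left: "dot (y + z) x = dot y x + dot z x"
  and dot_scale_right: "dot x (c *s y) = c * dot x y"
  and dot_scale_left: "dot (c *s y) x = c * dot y x"
  and dot_zero_right: "dot x 0 = 0"
  and dot_zero_left: "dot 0 x = 0"
  by (simp_all add: dot_def algebra_simps sum.distrib sum_distrib_left)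

lemma dot_diff_right: "dot x (y - z) = dot x y - dot x z"
  and dot_diff_left: "dot (y - z) x = dot y x - dot z x"
  for x :: "'a::field ^ 'n"
  by (simp_all add: dot_def algebra_simps sum_subtractf)

lemmas dot_linear = dot_add_right dot_add_left dot_scale_right dot_scale_left
  dot_zero_right dot_zero_left dot_diff_right dot_diff_left

lemma dot_axis: "dot (axis i c) x = c * x $ i"
proof -
  have "dot (axis i c) x = (\<Sum>j\<in>UNIV. if j = i then c * x $ j else 0)"
    unfolding dot_def by (rule sum.cong) (auto simp: axis_def)
  then show ?thesis by simp
qed

lemma dot_nonzero_functional:
  fixes x :: "'a::field ^ 'n"
  assumes "x \<noteq> 0"
  obtains \<theta> where "dot \<theta> x = 1"
proof -
  obtain i where "x $ i \<noteq> 0" using assms by (auto simp: vec_eq_iff)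
  then have "dot (axis i (1 / x $ i)) x = 1" by (simp add: dot_axis)
  then show thesis by (rule that)
qed

lemma form_linear:
  "form A x (y + z) = form A x y + form A x z"
  "form A x (y - z) = form A x y - form A x z"
  "form A x (c *s y) = c * form A x y"
  "form A x 0 = 0"
  "form A (x + x') y = form A x y + form A x' y"
  "form A (x - x') y = form A x y - form A x' y"
  "form A (c *s x) y = c * form A x y"
  "form A 0 y = 0"
  by (simp_all add: form_def dot_linear vec.add vec.diff vec.scale)

lemma form_matrix_linear:
  "form (A + B) x y = form A x y + form B x y"
  "form (A - B) x y = form A x y - form B x y"
  "form 0 x y = 0"
  by (simp_all add: form_def dot_linear matrix_vector_mult_add_rdistrib matrix_vector_mult_diff_rdistrib)

lemma form_alt: "form A x y = dot (x v* A) y"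
proof -
  have "form A x y = (\<Sum>i\<in>UNIV. \<Sum>j\<in>UNIV. x $ i * A $ i $ j * y $ j)"
    by (simp add: form_def dot_def matrix_vector_mult_def sum_distrib_left mult.assoc)
  also have "\<dots> = (\<Sum>j\<in>UNIV. \<Sum>i\<in>UNIV. x $ i * A $ i $ j * y $ j)"
    by (rule sum.swap)
  also have "\<dots> = dot (x v* A) y"
    by (simp add: dot_def vector_matrix_mult_def sum_distrib_right sum_distrib_left mult_ac)
  finally show ?thesis .
qed

lemma form_transpose: "form (transpose A) x y = form A y x"
  unfolding form_alt[of "transpose A"] by (simp add: form_def dot_commute)

lemma outer_mult_vec: "outer v w *v y = dot w y *s v" for v :: "'a::field ^ 'm"
  by (simp add: vec_eq_iff matrix_vector_mult_def outer_def dot_def sum_distrib_left mult_ac)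

lemma form_outer: "form (outer v w) x y = dot v x * dot w y"
  by (simp add: form_def outer_mult_vec dot_linear dot_commute)

lemma form_axis: "form A (axis i 1) (axis j 1) = A $ i $ j"
proof -
  have "(A *v axis j 1) $ i = dot (axis j 1) (A $ i)"
    by (simp add: matrix_vector_mult_def dot_def mult.commute)
  then show ?thesis by (simp add: form_def dot_axis)
qed

definition hyperplane :: "'a::field ^ 'n \<Rightarrow> ('a ^ 'n) set \<Rightarrow> ('a ^ 'n) set" where
  "hyperplane \<theta> U = {x \<in> U. dot \<theta> x = 0}"

lemma subspace_hyperplane: "vec.subspace U \<Longrightarrow> vec.subspace (hyperplane \<theta> U)"
  by (auto simp: vec.subspace_def hyperplane_def dot_linear)

lemma dim_hyperplane_ge:
  assumes U: "vec.subspace U"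
  shows "vec.dim U \<le> vec.dim (hyperplane \<theta> U) + 1"
proof (cases "\<exists>y\<in>U. dot \<theta> y \<noteq> 0")
  case True
  then obtain y where y: "y \<in> U" "dot \<theta> y \<noteq> 0" by blast
  have "x \<in> vec.span (insert y (hyperplane \<theta> U))" if "x \<in> U" for x
  proof -
    define c where "c = dot \<theta> x / dot \<theta> y"
    have "x - c *s y \<in> hyperplane \<theta> U"
      using that y U by (auto simp: hyperplane_def dot_linear c_def intro: vec.subspace_diff vec.subspace_scale)
    then show ?thesis
      by (auto simp: vec.span_insert intro: vec.span_base)
  qed
  then have "vec.dim U \<le> vec.dim (insert y (hyperplane \<theta> U))"
    by (intro vec.dim_mono) auto
  then show ?thesis by (auto simp: vec.dim_insert split: if_splits)
next
  case False
  then have "hyperplane \<theta> U = U" by (auto simp: hyperplane_def)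
  then show ?thesis by simp
qed

lemma dim_hyperplane_eq:
  assumes U: "vec.subspace U" and y: "y \<in> U" "dot \<theta> y \<noteq> 0"
  shows "vec.dim U = vec.dim (hyperplane \<theta> U) + 1"
proof -
  have sp: "vec.span U = U" "vec.span (hyperplane \<theta> U) = hyperplane \<theta> U"
    using U subspace_hyperplane[OF U] by (simp_all add: vec.span_eq_iff)
  have "vec.span (hyperplane \<theta> U) \<subset> vec.span U"
    unfolding sp using y by (auto simp: hyperplane_def)
  from vec.dim_psubset[OF this] dim_hyperplane_ge[OF U, of \<theta>] show ?thesis by linarith
qed

lemma dim_annihilator_ge:
  assumes "finite B" and U: "vec.subspace U"
  shows "vec.dim U \<le> vec.dim {x \<in> U. \<forall>b\<in>B. dot b x = 0} + card B"
  using assms(1)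
proof induction
  case empty
  then show ?case by simp
next
  case (insert b B)
  let ?W = "{x \<in> U. \<forall>b\<in>B. dot b x = 0}"
  have "vec.subspace ?W" using U by (auto simp: vec.subspace_def dot_linear)
  moreover have "{x \<in> U. \<forall>b\<in>insert b B. dot b x = 0} = hyperplane b ?W"
    by (auto simp: hyperplane_def)
  ultimately show ?case
    using dim_hyperplane_ge[of ?W b] insert by simp
qed

text \<open>The rank is the dimension of the row space, and each row of a basis of it cuts the dimension of
  the solution space by at most one.\<close>
lemma rank_nullity_ge:
  fixes M :: "'a::field ^ 'n ^ 'm"
  shows "CARD('n) \<le> vec.dim {x. M *v x = 0} + rank M"
proof -
  obtain B where B: "B \<subseteq> rows M" "vec.independent B" "rows M \<subseteq> vec.span B" "card B = vec.dim (rows M)"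
    by (rule vec.basis_exists)
  have "M *v x = 0" if x: "\<forall>b\<in>B. dot b x = 0" for x
  proof -
    have "dot b x = 0" if "b \<in> vec.span B" for b
      using that by (induction rule: vec.span_induct_alt) (auto simp: dot_linear x)
    moreover have "M $ i \<in> vec.span B" for i
      using B(3) by (auto simp: rows_def row_def vec_nth_inverse)
    ultimately have "dot (M $ i) x = 0" for i by blast
    then show ?thesis by (simp add: vec_eq_iff matrix_vector_mult_def dot_def)
  qed
  then have "vec.dim {x \<in> UNIV. \<forall>b\<in>B. dot b x = 0} \<le> vec.dim {x. M *v x = 0}"
    by (intro vec.dim_subset) auto
  with dim_annihilator_ge[OF vec.finiteI_independent[OF B(2)] vec.subspace_UNIV] B(4)
  show ?thesis unfolding row_rank_def_gen vec_dim_card by linarith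
qed

section \<open>Isotropic eigenvectors of the pencil\<close>

text \<open>A nonzero polynomial \<open>p\<close> with \<open>p(T) z = 0\<close> exists because the powers \<open>T\<^sup>i z\<close> cannot all be
  independent. Writing \<open>p = (X - \<mu>) q\<close>, either \<open>q(T) z\<close> is an eigenvector or \<open>q\<close> is such a polynomial of
  smaller degree.\<close>
lemma eigenvector_exists:
  fixes T :: "complex ^ 'n \<Rightarrow> complex ^ 'n"
  assumes T: "Vector_Spaces.linear (*s) (*s) T" and U: "vec.subspace U"
    and TU: "\<And>x. x \<in> U \<Longrightarrow> T x \<in> U" and z: "z \<in> U" "z \<noteq> 0"
  shows "\<exists>x\<in>U. x \<noteq> 0 \<and> (\<exists>\<mu>. T x = \<mu> *s x)"
proof -
  \<comment> \<open>the value \<open>p(T) z\<close>, computed by the Horner scheme\<close>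
  define act where "act p = fold_coeffs (\<lambda>a v. a *s z + T v) p 0" for p
  have T0: "T 0 = 0" and Ta: "T (x + y) = T x + T y" and Ts: "T (c *s x) = c *s T x" for x y c
    using T by (simp_all add: vec.linear_0 vec.linear_add vec.linear_scale)
  have act_0: "act 0 = 0" by (simp add: act_def)
  have act_pCons: "act (pCons a p) = a *s z + T (act p)" for a p
    by (cases "p = 0 \<and> a = 0") (auto simp: act_def T0)
  have act_add: "act (p + q) = act p + act q" for p q
    by (induction p q rule: poly_induct2) (simp_all add: act_0 act_pCons Ta algebra_simps)
  have act_smult: "act (smult c p) = c *s act p" for c p
    by (induction p) (simp_all add: act_0 act_pCons Ts vector_add_ldistrib)
  have act_U: "act p \<in> U" for p
    by (induction p) (use U z TU in \<open>auto simp: act_0 act_pCons intro: vec.subspace_0 vec.subspace_add vec.subspace_scale\<close>)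
  have act_monom: "act (monom c i) = c *s (T ^^ i) z" for c i
    by (induction i) (simp_all add: monom_0 monom_Suc act_0 act_pCons T0 Ts)
  have act_sum: "act (\<Sum>i\<in>I. f i) = (\<Sum>i\<in>I. act (f i))" if "finite I" for I and f :: "nat \<Rightarrow> complex poly"
    using that by induction (simp_all add: act_0 act_add)
  have annih: "\<exists>p. p \<noteq> 0 \<and> act p = 0"
  proof (cases "inj_on (\<lambda>i. (T ^^ i) z) {..CARD('n)}")
    case True
    let ?S = "(\<lambda>i. (T ^^ i) z) ` {..CARD('n)}"
    have "card ?S = Suc CARD('n)" using True by (simp add: card_image)
    then have "vec.dependent ?S"
      using vec.dependent_biggerset_general[of ?S] vec.dim_subset[OF subset_UNIV, of ?S]
      by (simp add: card_cart_basis)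
    then obtain c v where v: "v \<in> ?S" "c v \<noteq> 0" and sum: "(\<Sum>v\<in>?S. c v *s v) = 0"
      unfolding vec.dependent_finite[OF finite_imageI[OF finite_atMost]] by blast
    define p where "p = (\<Sum>i\<le>CARD('n). monom (c ((T ^^ i) z)) i)"
    have "act p = (\<Sum>i\<le>CARD('n). c ((T ^^ i) z) *s (T ^^ i) z)"
      by (simp add: p_def act_sum act_monom)
    also have "\<dots> = 0" using sum by (simp add: sum.reindex[OF True])
    finally have "act p = 0" .
    moreover obtain i where i: "i \<le> CARD('n)" "v = (T ^^ i) z" using v by auto
    have "coeff p i = c v" using i by (simp add: p_def coeff_sum)
    then have "p \<noteq> 0" using v(2) by auto
    ultimately show ?thesis by blast
  next
    case False
    then obtain i j where ij: "i \<noteq> j" "(T ^^ i) z = (T ^^ j) z" by (auto simp: inj_on_def)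
    have "act (monom 1 i + smult (-1) (monom 1 j)) = 0"
      unfolding act_add act_smult act_monom using ij by (simp add: vec_eq_iff)
    moreover have "coeff (monom 1 i + smult (-1) (monom 1 j) :: complex poly) i \<noteq> 0"
      using ij(1) by simp
    then have "monom 1 i + smult (-1) (monom 1 j) \<noteq> (0 :: complex poly)" by (metis coeff_0)
    ultimately show ?thesis by blast
  qed
  have "\<exists>x\<in>U. x \<noteq> 0 \<and> (\<exists>\<mu>. T x = \<mu> *s x)" if "p \<noteq> 0" "act p = 0" for p
    using that
  proof (induction "degree p" arbitrary: p rule: less_induct)
    case less
    have "degree p \<noteq> 0"
    proof
      assume "degree p = 0"
      then obtain c where "p = [:c:]" by (rule degree_eq_zeroE)
      with less.prems z show False by (auto simp: act_pCons act_0 T0 vec_eq_iff)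
    qed
    then obtain \<mu> where "poly p \<mu> = 0"
      using fundamental_theorem_of_algebra[of p] by (auto simp: constant_degree)
    then obtain q where q: "p = [:- \<mu>, 1:] * q" by (auto simp: poly_eq_0_iff_dvd)
    have q0: "q \<noteq> 0" using q less.prems by auto
    have deg: "degree q < degree p" unfolding q using q0 by (subst degree_mult_eq) auto
    have "p = smult (- \<mu>) q + pCons 0 q" by (simp add: q)
    then have "act p = (- \<mu>) *s act q + (0 *s z + T (act q))"
      by (simp only: act_add act_smult act_pCons)
    with less.prems have eig: "T (act q) = \<mu> *s act q" by (simp add: vec_eq_iff)
    show ?case
    proof (cases "act q = 0")
      case True with less.hyps[OF deg q0] show ?thesis by blast
    next
      case False with eig act_U show ?thesis by blast
    qed
  qed
  with annih show ?thesis by blast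
qed


text \<open>Let \<open>G\<close> and \<open>F\<close> map \<open>x\<close> to the functionals \<open>A(x,-)\<close> and \<open>A(-,x)\<close> on \<open>U\<close>. If \<open>G\<close> is not
  injective, a kernel vector will do. Otherwise \<open>G\<close> is an isomorphism of \<open>U\<close> onto its dual, and an
  eigenvector of \<open>G\<^sup>-\<^sup>1 F\<close> will do. The pair \<open>(\<alpha>, \<beta>)\<close> is a point of the projective line, so that
  infinite eigenvalues are included.\<close>
lemma pencil_eigenvector:
  fixes A :: "complex ^ 'n ^ 'n"
  assumes U: "vec.subspace U" and nz: "\<exists>x\<in>U. x \<noteq> 0"
  shows "\<exists>x\<in>U. x \<noteq> 0 \<and> (\<exists>\<alpha> \<beta>. (\<alpha> \<noteq> 0 \<or> \<beta> \<noteq> 0) \<and> (\<forall>y\<in>U. \<alpha> * form A y x = \<beta> * form A x y))"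
proof (cases "\<exists>x\<in>U. x \<noteq> 0 \<and> (\<forall>y\<in>U. form A x y = 0)")
  case True
  then obtain x where "x \<in> U" "x \<noteq> 0" "\<forall>y\<in>U. form A x y = 0" by blast
  then have "x \<in> U \<and> x \<noteq> 0 \<and> (\<forall>y\<in>U. 0 * form A y x = 1 * form A x y)" by simp
  then show ?thesis by (metis one_neq_zero)
next
  case nondeg: False
  obtain B where B: "B \<subseteq> U" "vec.independent B" "U \<subseteq> vec.span B" "card B = vec.dim U"
    by (rule vec.basis_exists)
  have finB: "finite B" using B(2) by (rule vec.finiteI_independent)
  have "card B \<le> CARD('n)"
    using vec.dim_subset[OF subset_UNIV, of U] B(4) by (simp add: card_cart_basis)
  then obtain idx :: "complex ^ 'n \<Rightarrow> 'n" where idx: "inj_on idx B"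
    using finB by (metis card_le_inj finite_class.finite_UNIV)
  \<comment> \<open>a copy of the dual of \<open>U\<close> inside the coordinate space: the tuples of values on the basis \<open>B\<close>\<close>
  define V :: "(complex ^ 'n) set" where "V = {v. \<forall>i. i \<notin> idx ` B \<longrightarrow> v $ i = 0}"
  define vals :: "(complex ^ 'n \<Rightarrow> complex) \<Rightarrow> complex ^ 'n"
    where "vals f = (\<chi> i. if i \<in> idx ` B then f (the_inv_into B idx i) else 0)" for f
  have vals_V: "vals f \<in> V" for f by (simp add: vals_def V_def)
  have vals_eqD: "f b = g b" if "vals f = vals g" "b \<in> B" for f g b
  proof -
    have "vals f $ idx b = vals g $ idx b" using that by simp
    then show ?thesis using that(2) by (simp add: vals_def the_inv_into_f_f[OF idx])
  qed
  define F G where "F z = vals (\<lambda>b. form A b z)" and "G z = vals (\<lambda>b. form A z b)" for z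
  have linF: "Vector_Spaces.linear (*s) (*s) F" and linG: "Vector_Spaces.linear (*s) (*s) G"
    by (unfold_locales; simp add: F_def G_def vals_def vec_eq_iff form_linear)+
  have spanU: "vec.span U = U" using U by (simp add: vec.span_eq_iff)
  have agree_on_U: "form A x y = 0" if "x \<in> U" "\<forall>b\<in>B. form A x b = 0" "y \<in> U" for x y
  proof -
    have "y \<in> vec.span B" using B(3) that(3) by blast
    then show ?thesis
      by (induction rule: vec.span_induct_alt) (auto simp: form_linear that(2))
  qed
  have injG: "inj_on G U"
  proof (rule inj_onI)
    fix x y assume xy: "x \<in> U" "y \<in> U" "G x = G y"
    then have "\<forall>b\<in>B. form A (x - y) b = 0"
      using vals_eqD unfolding G_def by (fastforce simp: form_linear)
    moreover have "x - y \<in> U" using U xy by (simp add: vec.subspace_diff)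
    ultimately have "x - y = 0" using nondeg agree_on_U by blast
    then show "x = y" by simp
  qed
  have dimV: "vec.dim V \<le> card B"
  proof -
    have "v \<in> vec.span ((\<lambda>i. axis i 1) ` idx ` B)" if "v \<in> V" for v
    proof -
      have "v = (\<Sum>i\<in>idx ` B. v $ i *s axis i 1)"
        using that by (auto simp: vec_eq_iff V_def axis_def sum.delta finB if_distrib cong: if_cong)
      also have "\<dots> \<in> vec.span ((\<lambda>i. axis i 1) ` idx ` B)"
        by (intro vec.span_sum vec.span_scale vec.span_base) auto
      finally show ?thesis .
    qed
    then have "vec.dim V \<le> vec.dim ((\<lambda>i. axis i 1 :: complex ^ 'n) ` idx ` B)"
      by (intro vec.dim_mono) auto
    also have "\<dots> \<le> card B"
      using finB by (intro order.trans[OF vec.dim_le_card'] order.trans[OF card_image_le] card_image_le) auto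
    finally show ?thesis .
  qed
  have "vec.dim (G ` U) = vec.dim U"
    using vec.dim_image_eq[OF linG] injG by (simp add: spanU)
  moreover have "vec.subspace (G ` U)" by (rule vec.linear_subspace_image[OF linG U])
  moreover have "vec.subspace V" by (auto simp: V_def vec.subspace_def)
  ultimately have GU: "G ` U = V"
    using dimV B(4) by (intro vec.subspace_dim_equal) (auto simp: G_def vals_V)
  obtain g where g: "Vector_Spaces.linear (*s) (*s) g" "g ` UNIV \<subseteq> U" "\<And>v. v \<in> U \<Longrightarrow> g (G v) = v"
    using vec.linear_exists_left_inverse_on[OF linG U injG] by (auto simp: spanU)
  have "Vector_Spaces.linear (*s) (*s) (g \<circ> F)" by (rule Vector_Spaces.linear_compose[OF linF g(1)])
  moreover obtain z where "z \<in> U" "z \<noteq> 0" using nz by blast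
  moreover have "(g \<circ> F) x \<in> U" for x using g(2) by auto
  ultimately have "\<exists>x\<in>U. x \<noteq> 0 \<and> (\<exists>\<mu>. (g \<circ> F) x = \<mu> *s x)"
    by (intro eigenvector_exists[OF _ U])
  then obtain x \<mu> where x: "x \<in> U" "x \<noteq> 0" "g (F x) = \<mu> *s x" by auto
  have "F x \<in> G ` U" using GU vals_V by (simp add: F_def)
  then obtain t where t: "t \<in> U" "F x = G t" by blast
  then have "t = \<mu> *s x" using g(3) x(3) by simp
  then have Fx: "F x = G (\<mu> *s x)" using t by simp
  have B0: "form A b x = \<mu> * form A x b" if "b \<in> B" for b
    using vals_eqD[OF Fx[unfolded F_def G_def] that] by (simp add: form_linear)
  have "1 * form A y x = \<mu> * form A x y" if "y \<in> U" for y
  proof -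
    have "y \<in> vec.span B" using that B(3) by blast
    then show ?thesis
      by (induction rule: vec.span_induct_alt) (auto simp: form_linear B0 algebra_simps)
  qed
  then show ?thesis using x by (metis one_neq_zero)
qed

text \<open>Putting \<open>y = x\<close> in the eigenvector equation gives \<open>(\<alpha> - \<beta>) A(x,x) = 0\<close>, so only the eigenvalue
  \<open>\<alpha> = \<beta>\<close> can have a non-isotropic eigenvector \<open>x\<close>. In that case \<open>U\<close> is the orthogonal sum of
  the line of \<open>x\<close> and a nonzero space \<open>W\<close>, and every eigenvector \<open>y\<close> in \<open>W\<close> is one in \<open>U\<close>. If it is not
  isotropic either, then \<open>x\<close> and \<open>y\<close> have the same eigenvalue, and their span contains an
  isotropic vector.\<close>
lemma isotropic_pencil_eigenvector:
  fixes A :: "complex ^ 'n ^ 'n"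
  assumes U: "vec.subspace U" and dim: "vec.dim U \<ge> 2"
  obtains x \<alpha> \<beta> where "x \<in> U" "x \<noteq> 0" "form A x x = 0" "\<alpha> \<noteq> 0 \<or> \<beta> \<noteq> 0"
    "\<And>y. y \<in> U \<Longrightarrow> \<alpha> * form A y x = \<beta> * form A x y"
proof -
  let ?eig = "\<lambda>W x \<alpha> \<beta>. (\<alpha> \<noteq> 0 \<or> \<beta> \<noteq> 0) \<and> (\<forall>y\<in>W. \<alpha> * form A y x = \<beta> * form A x y)"
  have nz: "\<exists>x\<in>W. x \<noteq> 0" if "vec.dim W \<noteq> 0" for W :: "(complex ^ 'n) set"
    using that by (auto simp: vec.dim_eq_0)
  have "vec.dim U \<noteq> 0" using dim by linarith
  then obtain x \<alpha> \<beta> where x: "x \<in> U" "x \<noteq> 0" and eigx: "?eig U x \<alpha> \<beta>"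
    using pencil_eigenvector[OF U nz, of A] by blast
  show thesis
  proof (cases "form A x x = 0")
    case True
    with x eigx that show ?thesis by blast
  next
    case nxx: False
    from eigx x nxx have "\<alpha> = \<beta>" by (metis mult_right_cancel)
    with eigx have symx: "form A y x = form A x y" if "y \<in> U" for y using that by auto
    define W where "W = hyperplane (x v* A) U"
    have W: "vec.subspace W" unfolding W_def using U by (rule subspace_hyperplane)
    have W_iff: "y \<in> W \<longleftrightarrow> y \<in> U \<and> form A x y = 0" for y
      by (simp add: W_def hyperplane_def form_alt)
    have "vec.dim W \<noteq> 0" using dim_hyperplane_ge[OF U, of "x v* A"] dim unfolding W_def by linarith
    then obtain y \<gamma> \<delta> where y: "y \<in> W" "y \<noteq> 0" and eigy: "?eig W y \<gamma> \<delta>"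
      using pencil_eigenvector[OF W nz, of A] by blast
    have eigyU: "\<gamma> * form A z y = \<delta> * form A y z" if z: "z \<in> U" for z
    proof -
      define c where "c = form A x z / form A x x"
      have "z - c *s x \<in> W"
        using z x U nxx by (auto simp: W_iff form_linear c_def intro: vec.subspace_diff vec.subspace_scale)
      then have "\<gamma> * form A (z - c *s x) y = \<delta> * form A y (z - c *s x)" using eigy by blast
      moreover have "form A x y = 0" "form A y x = 0" using y symx by (auto simp: W_iff)
      ultimately show ?thesis by (simp add: form_linear)
    qed
    have yU: "y \<in> U" "form A x y = 0" "form A y x = 0" using y symx by (auto simp: W_iff)
    show ?thesis
    proof (cases "form A y y = 0")
      case True
      then show ?thesis using that[OF yU(1) y(2) True, of \<gamma> \<delta>] eigy eigyU by blast
    next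
      case nyy: False
      from eigy y nyy have gd: "\<gamma> = \<delta>" "\<gamma> \<noteq> 0" by (metis mult_right_cancel)+
      then have symy: "form A z y = form A y z" if "z \<in> U" for z using eigyU[OF that] by auto
      define c where "c = csqrt (- form A x x / form A y y)"
      have c2: "c * c = - form A x x / form A y y"
        unfolding c_def by (metis power2_csqrt power2_eq_square)
      let ?v = "x + c *s y"
      show ?thesis
      proof (rule that[of ?v 1 1])
        show "?v \<in> U" using x yU U by (auto intro: vec.subspace_add vec.subspace_scale)
        have "form A x ?v = form A x x" by (simp add: form_linear yU)
        with nxx show "?v \<noteq> 0" by (metis form_linear(4))
        have "form A ?v ?v = form A x x + c * c * form A y y"
          by (simp add: form_linear yU algebra_simps)
        then show "form A ?v ?v = 0" using nyy by (simp add: c2)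
        show "1 * form A z ?v = 1 * form A ?v z" if "z \<in> U" for z
          using symx[OF that] symy[OF that] by (simp add: form_linear)
      qed simp
    qed
  qed
qed



section \<open>Extending decompositions\<close>

text \<open>The matrices \<open>[u u\<^sup>T] + \<Sum>\<^sub>j (v\<^sub>j a\<^sub>j\<^sup>T - b\<^sub>j v\<^sub>j\<^sup>T)\<close> with \<open>r\<close> counting 2 for each term
  of the sum and 1 for the square. An inductive definition matches the induction in which
  they are produced.\<close>
inductive split_form :: "nat \<Rightarrow> 'a::field ^ 'n ^ 'n \<Rightarrow> bool" where
  zero: "split_form 0 0"
| square: "split_form 1 (outer u u)"
| step: "split_form r D \<Longrightarrow> split_form (r + 2) (D + outer v a - outer b v)"

lemma outer_zero: "outer 0 w = (0 :: 'a::field ^ 'n ^ 'm)" "outer v 0 = (0 :: 'a::field ^ 'n ^ 'm)"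
  by (simp_all add: outer_def vec_eq_iff)

lemma split_form_weaken: "split_form r D \<Longrightarrow> split_form (r + 2) D"
  using split_form.step[of r D 0 0 0] by (simp add: outer_zero)

lemma split_form_zero: "split_form r 0"
proof (induction r rule: induct_nat_012)
  case 1
  show ?case using split_form.square[of 0] by (simp add: outer_zero)
next
  case (ge2 n)
  then show ?case using split_form_weaken by fastforce
qed (rule split_form.zero)

text \<open>Substituting \<open>M x\<close> for \<open>x\<close> in both arguments only changes the functionals.\<close>
lemma split_form_congruence:
  assumes "split_form r D"
  shows "\<exists>D'. split_form r D' \<and> (\<forall>x y. form D' x y = form D (M *v x) (M *v y))"
  using assms
proof induction
  case zero
  then show ?case by (metis form_matrix_linear(3) split_form.zero)
next
  case (square u)
  have "form (outer (u v* M) (u v* M)) x y = form (outer u u) (M *v x) (M *v y)" for x y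
    by (simp add: form_outer flip: form_alt form_def)
  then show ?case by (metis split_form.square)
next
  case (step r D v a b)
  then obtain D' where D': "split_form r D'" "\<And>x y. form D' x y = form D (M *v x) (M *v y)"
    by blast
  have "form (D' + outer (v v* M) (a v* M) - outer (b v* M) (v v* M)) x y
      = form (D + outer v a - outer b v) (M *v x) (M *v y)" for x y
    by (simp add: form_outer form_matrix_linear D'(2) flip: form_alt form_def)
  then show ?case using split_form.step[OF D'(1)] by blast
qed

definition agree_on :: "('a::field ^ 'n) set \<Rightarrow> 'a ^ 'n ^ 'n \<Rightarrow> 'a ^ 'n ^ 'n \<Rightarrow> bool" where
  "agree_on U A D \<longleftrightarrow> (\<forall>x\<in>U. \<forall>y\<in>U. form A x y = form D x y)"

text \<open>Choose \<open>y \<in> U\<close> with \<open>\<theta>(y) = 1\<close>. The difference \<open>E = A - D\<close> vanishes at the projections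
  \<open>z - \<theta>(z) y\<close> and \<open>w - \<theta>(w) y\<close> to the hyperplane; expanding,
  \<open>E(z,w) = \<theta>(z) (E(y,w) - E(y,y) \<theta>(w)) + E(z,y) \<theta>(w)\<close>.\<close>
lemma split_form_extend_hyperplane:
  assumes U: "vec.subspace U" and D: "split_form r D" and agree: "agree_on (hyperplane \<theta> U) A D"
  shows "\<exists>D'. split_form (r + 2) D' \<and> agree_on U A D'"
proof (cases "\<exists>y\<in>U. dot \<theta> y \<noteq> 0")
  case False
  then have "hyperplane \<theta> U = U" by (auto simp: hyperplane_def)
  with D agree show ?thesis using split_form_weaken by metis
next
  case True
  then obtain y0 where y0: "y0 \<in> U" "dot \<theta> y0 \<noteq> 0" by blast
  define y where "y = (1 / dot \<theta> y0) *s y0"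
  have y: "y \<in> U" "dot \<theta> y = 1"
    using y0 U by (auto simp: y_def dot_linear intro: vec.subspace_scale)
  define E where "E = A - D"
  define a where "a = y v* E - form E y y *s \<theta>"
  define b where "b = - 1 *s (E *v y)"
  let ?D' = "D + outer \<theta> a - outer b \<theta>"
  have "form A z w = form ?D' z w" if zw: "z \<in> U" "w \<in> U" for z w
  proof -
    have "z - dot \<theta> z *s y \<in> hyperplane \<theta> U" "w - dot \<theta> w *s y \<in> hyperplane \<theta> U"
      using zw y U by (auto simp: hyperplane_def dot_linear intro: vec.subspace_diff vec.subspace_scale)
    then have "form E (z - dot \<theta> z *s y) (w - dot \<theta> w *s y) = 0"
      using agree by (simp add: E_def form_matrix_linear agree_on_def)
    then have "form E z w = dot \<theta> w * form E z y + dot \<theta> z * form E y w - dot \<theta> z * dot \<theta> w * form E y y"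
      by (simp add: form_linear algebra_simps)
    moreover have "dot \<theta> z * dot a w = dot \<theta> z * form E y w - dot \<theta> z * dot \<theta> w * form E y y"
      by (simp add: a_def dot_linear form_alt algebra_simps)
    moreover have "dot b z = - form E z y"
      unfolding b_def dot_linear by (simp add: form_def dot_commute)
    ultimately have "form E z w = form (outer \<theta> a) z w - form (outer b \<theta>) z w"
      by (simp add: form_outer mult.commute)
    then show ?thesis by (simp add: E_def form_matrix_linear algebra_simps)
  qed
  then show ?thesis using split_form.step[OF D] unfolding agree_on_def by blast
qed

text \<open>The projection to the hyperplane along a vector \<open>x\<close> of both radicals does not change the form on
  \<open>U\<close>, so a decomposition on the hyperplane can be pulled back along it.\<close>
lemma split_form_extend_radical:
  assumes U: "vec.subspace U" and D: "split_form r D" and agree: "agree_on (hyperplane \<theta> U) A D"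
    and x: "x \<in> U" "dot \<theta> x = 1" and rad: "\<And>y. y \<in> U \<Longrightarrow> form A x y = 0 \<and> form A y x = 0"
  shows "\<exists>D'. split_form r D' \<and> agree_on U A D'"
proof -
  define M where "M = mat 1 - outer x \<theta>"
  have M: "M *v z = z - dot \<theta> z *s x" for z
    by (simp add: M_def matrix_vector_mult_diff_rdistrib outer_mult_vec)
  obtain D' where D': "split_form r D'" "\<And>y z. form D' y z = form D (M *v y) (M *v z)"
    using split_form_congruence[OF D, of M] by blast
  have "form A y z = form D' y z" if yz: "y \<in> U" "z \<in> U" for y z
  proof -
    have "M *v y \<in> hyperplane \<theta> U" "M *v z \<in> hyperplane \<theta> U"
      using yz x U by (auto simp: M hyperplane_def dot_linear intro: vec.subspace_diff vec.subspace_scale)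
    then have "form D' y z = form A (M *v y) (M *v z)" using agree by (simp add: D' agree_on_def)
    also have "\<dots> = form A y z" using yz x rad by (simp add: M form_linear)
    finally show ?thesis by simp
  qed
  then show ?thesis using D' unfolding agree_on_def by blast
qed

section \<open>Nullity of the restricted pencil\<close>

text \<open>The kernel of \<open>A - l A\<^sup>T\<close> viewed as a map from \<open>U\<close> to its dual.\<close>
definition pencil_kernel :: "'a::field ^ 'n ^ 'n \<Rightarrow> 'a \<Rightarrow> ('a ^ 'n) set \<Rightarrow> ('a ^ 'n) set" where
  "pencil_kernel A l U = {z \<in> U. \<forall>y\<in>U. form A y z = l * form A z y}"

lemma subspace_pencil_kernel: "vec.subspace U \<Longrightarrow> vec.subspace (pencil_kernel A l U)"
  by (auto simp: vec.subspace_def pencil_kernel_def form_linear algebra_simps)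

lemma hyperplane_pencil_kernel_subset:
  "hyperplane \<theta> (pencil_kernel A l U) \<subseteq> pencil_kernel A l (hyperplane \<theta> U)"
  by (auto simp: hyperplane_def pencil_kernel_def)

text \<open>Pairing with \<open>x\<close> shows that a kernel vector \<open>z\<close> satisfies \<open>(p - l q) \<theta>(z) = 0\<close>, so it lies in the
  hyperplane; pairing \<open>x\<close> with \<open>y\<close> gives \<open>(q - l p) \<theta>(y) \<noteq> 0\<close>, so \<open>x\<close> is not a kernel vector. On the
  hyperplane, however, \<open>x\<close> is in both radicals.\<close>
lemma pencil_kernel_grows:
  fixes A :: "'a::field ^ 'n ^ 'n"
  assumes U: "vec.subspace U" and x: "x \<in> U" "form A x x = 0"
    and left: "\<And>y. y \<in> U \<Longrightarrow> form A x y = p * dot \<theta> y"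
    and right: "\<And>y. y \<in> U \<Longrightarrow> form A y x = q * dot \<theta> y"
    and y: "y \<in> U" "dot \<theta> y \<noteq> 0"
    and l: "p \<noteq> l * q" "q \<noteq> l * p"
  shows "vec.dim (pencil_kernel A l U) + 1 \<le> vec.dim (pencil_kernel A l (hyperplane \<theta> U))"
proof -
  let ?K = "pencil_kernel A l U"
  have sub: "?K \<subseteq> hyperplane \<theta> U"
  proof
    fix z assume z: "z \<in> ?K"
    then have "form A x z = l * form A z x" "z \<in> U" using x by (auto simp: pencil_kernel_def)
    then have "(p - l * q) * dot \<theta> z = 0" by (simp add: left right algebra_simps)
    with l \<open>z \<in> U\<close> show "z \<in> hyperplane \<theta> U" by (simp add: hyperplane_def)
  qed
  have "x \<notin> ?K"
  proof
    assume "x \<in> ?K"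
    then have "form A y x = l * form A x y" using y by (auto simp: pencil_kernel_def)
    then have "(q - l * p) * dot \<theta> y = 0" using y by (simp add: left right algebra_simps)
    with y l show False by simp
  qed
  moreover have "vec.span ?K = ?K" using subspace_pencil_kernel[OF U] by (simp add: vec.span_eq_iff)
  ultimately have "vec.dim (insert x ?K) = vec.dim ?K + 1" by (simp add: vec.dim_insert del: vec.span_eq_iff)
  moreover have "dot \<theta> x = 0" using l left[OF x(1)] right[OF x(1)] x(2) by auto
  then have "x \<in> pencil_kernel A l (hyperplane \<theta> U)"
    using x left right by (auto simp: pencil_kernel_def hyperplane_def)
  moreover have "?K \<subseteq> pencil_kernel A l (hyperplane \<theta> U)"
    using sub by (auto simp: pencil_kernel_def hyperplane_def)
  ultimately show ?thesis
    using vec.dim_subset[of "insert x ?K" "pencil_kernel A l (hyperplane \<theta> U)"] by auto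
qed

lemma form_on_line:
  fixes A :: "complex ^ 'n ^ 'n"
  assumes U: "vec.subspace U" and dim: "vec.dim U = 1" and x: "x \<in> U" "dot \<theta> x = 1"
  shows "agree_on U A (outer (csqrt (form A x x) *s \<theta>) (csqrt (form A x x) *s \<theta>))"
proof -
  have "vec.dim (hyperplane \<theta> U) = 0" using dim_hyperplane_eq[OF U, of x \<theta>] x dim by simp
  then have h: "hyperplane \<theta> U \<subseteq> {0}" by simp
  have eq: "z = dot \<theta> z *s x" if "z \<in> U" for z
  proof -
    have "z - dot \<theta> z *s x \<in> hyperplane \<theta> U"
      using that x U by (auto simp: hyperplane_def dot_linear intro: vec.subspace_diff vec.subspace_scale)
    with h show ?thesis by auto
  qed
  have "form A y z = dot \<theta> y * dot \<theta> z * form A x x" if "y \<in> U" "z \<in> U" for y z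
    by (subst eq[OF that(1)], subst eq[OF that(2)]) (simp add: form_linear)
  moreover have "csqrt c * csqrt c = c" for c by (metis power2_csqrt power2_eq_square)
  ultimately show ?thesis
    by (simp add: agree_on_def form_outer dot_linear)
qed

section \<open>Decomposition of a form by the rank of its pencil\<close>

text \<open>The pencil on \<open>U\<close> has generic nullity at least \<open>k\<close>, so \<open>r\<close> bounds its generic rank. The set of
  exceptions has to be finite instead of empty because each use of \<open>pencil_kernel_grows\<close> adds some. The
  slack in the inequality between \<open>dim U\<close> and \<open>k + r\<close> covers the truncated difference \<open>k - 1\<close> when a
  radical vector is split off for \<open>k = 0\<close>.\<close>
lemma split_form_exists:
  fixes A :: "complex ^ 'n ^ 'n"
  assumes "vec.subspace U" and "finite {l. vec.dim (pencil_kernel A l U) < k}"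
    and "vec.dim U \<le> k + r"
  shows "\<exists>D. split_form r D \<and> agree_on U A D"
  using assms
proof (induction "vec.dim U" arbitrary: U k r rule: less_induct)
  case less
  note U = less.prems(1) and fin = less.prems(2) and dimU = less.prems(3)
  have ex_good: "\<exists>l. l \<notin> S \<and> vec.dim (pencil_kernel A l U) \<ge> k" if "finite S" for S
  proof -
    have "finite (S \<union> {l. vec.dim (pencil_kernel A l U) < k})" using that fin by simp
    then obtain l where "l \<notin> S \<union> {l. vec.dim (pencil_kernel A l U) < k}"
      using ex_new_if_finite[OF infinite_UNIV_char_0] by blast
    then show ?thesis by auto
  qed
  consider "vec.dim U = 0" | "vec.dim U = 1" | "vec.dim U \<ge> 2" by linarith
  then show ?case
  proof cases
    case 1
    then have "U \<subseteq> {0}" by simp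
    then have "agree_on U A 0" unfolding agree_on_def by (auto simp: form_linear)
    then show ?thesis using split_form_zero by blast
  next
    case 2
    then have "\<not> U \<subseteq> {0}" by (metis vec.dim_eq_0 zero_neq_one)
    then obtain x where x: "x \<in> U" "x \<noteq> 0" by blast
    obtain \<theta> where \<theta>: "dot \<theta> x = 1" using dot_nonzero_functional[OF x(2)] .
    note line = form_on_line[OF U 2 x(1) \<theta>, of A]
    consider "r = 0" | "r = 1" | r' where "r = r' + 2" by (metis One_nat_def add_2_eq_Suc' not0_implies_Suc)
    then show ?thesis
    proof cases
      case 1
      \<comment> \<open>the pencil vanishes on the line, and \<open>A(x,x) = l A(x,x)\<close> is conclusive for \<open>l \<noteq> 1\<close>\<close>
      obtain l where l: "l \<noteq> 1" "vec.dim (pencil_kernel A l U) \<ge> k" using ex_good[of "{1}"] by auto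
      have "pencil_kernel A l U = U"
        using l dimU 1 U subspace_pencil_kernel[OF U]
        by (intro vec.subspace_dim_equal) (auto simp: pencil_kernel_def)
      then have "form A x x = l * form A x x" using x(1) unfolding pencil_kernel_def by blast
      with l have "form A x x = 0" by simp
      with line show ?thesis using 1 split_form.zero by (auto simp: outer_zero)
    next
      case 2
      with line show ?thesis using split_form.square by blast
    next
      case 3
      have "vec.dim (hyperplane \<theta> U) = 0" using dim_hyperplane_eq[OF U, of x \<theta>] x \<theta> 2 by simp
      then have "agree_on (hyperplane \<theta> U) A 0" by (auto simp: agree_on_def form_linear)
      then show ?thesis using split_form_extend_hyperplane[OF U split_form_zero] 3 by blast
    qed
  next
    case 3
    obtain x \<alpha> \<beta> where x: "x \<in> U" "x \<noteq> 0" "form A x x = 0" and ab: "\<alpha> \<noteq> 0 \<or> \<beta> \<noteq> 0"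
      and eig: "\<And>y. y \<in> U \<Longrightarrow> \<alpha> * form A y x = \<beta> * form A x y"
      using isotropic_pencil_eigenvector[OF U 3, of A] by metis
    obtain \<theta> p q where pq: "p \<noteq> 0 \<or> q \<noteq> 0"
      and left: "\<And>y. y \<in> U \<Longrightarrow> form A x y = p * dot \<theta> y"
      and right: "\<And>y. y \<in> U \<Longrightarrow> form A y x = q * dot \<theta> y"
    proof (cases "\<alpha> = 0")
      case True
      with ab eig show thesis
        by (intro that[of 0 1 "A *v x"]) (auto simp: form_def dot_commute)
    next
      case False
      with eig show thesis
        by (intro that[of 1 "\<beta> / \<alpha>" "x v* A"]) (auto simp: field_simps simp flip: form_alt)
    qed
    show ?thesis
    proof (cases "\<exists>y\<in>U. dot \<theta> y \<noteq> 0")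
      case True
      then obtain y where y: "y \<in> U" "dot \<theta> y \<noteq> 0" by blast
      have dimH: "vec.dim U = vec.dim (hyperplane \<theta> U) + 1" by (rule dim_hyperplane_eq[OF U y])
      \<comment> \<open>if \<open>p\<close> or \<open>q\<close> is 0, then \<open>?S = {0}\<close>, and 0 is indeed the only bad value\<close>
      let ?S = "{p / q, q / p}"
      have good: "vec.dim (pencil_kernel A l U) + 1 \<le> vec.dim (pencil_kernel A l (hyperplane \<theta> U))"
        if "l \<notin> ?S" for l
      proof (rule pencil_kernel_grows[OF U x(1,3) left right y])
        show "p \<noteq> l * q" "q \<noteq> l * p" using that pq by (auto simp: field_simps)
      qed
      have "{l. vec.dim (pencil_kernel A l (hyperplane \<theta> U)) < k + 1}
          \<subseteq> ?S \<union> {l. vec.dim (pencil_kernel A l U) < k}"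
        using good by fastforce
      then have fin': "finite {l. vec.dim (pencil_kernel A l (hyperplane \<theta> U)) < k + 1}"
        by (rule finite_subset) (use fin in simp)
      \<comment> \<open>one good \<open>l\<close> shows that the bound \<open>r\<close> leaves room for a drop by 2\<close>
      obtain l where "l \<notin> ?S" "vec.dim (pencil_kernel A l U) \<ge> k" using ex_good[of ?S] by auto
      then have "k + 1 \<le> vec.dim (pencil_kernel A l (hyperplane \<theta> U))" using good by force
      also have "\<dots> \<le> vec.dim (hyperplane \<theta> U)" by (rule vec.dim_subset) (auto simp: pencil_kernel_def)
      finally have "r \<ge> 2" using dimH dimU by linarith
      then obtain r' where r': "r = r' + 2" by (metis add.commute le_Suc_ex)
      have "\<exists>D. split_form r' D \<and> agree_on (hyperplane \<theta> U) A D"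
        using dimH dimU r' by (intro less.hyps[OF _ subspace_hyperplane[OF U] fin']) auto
      then show ?thesis using split_form_extend_hyperplane[OF U] r' by blast
    next
      case False
      then have rad: "form A x y = 0 \<and> form A y x = 0" if "y \<in> U" for y
        using that left right by auto
      obtain \<eta> where \<eta>: "dot \<eta> x = 1" using dot_nonzero_functional[OF x(2)] .
      have dimH: "vec.dim U = vec.dim (hyperplane \<eta> U) + 1" using \<eta> by (intro dim_hyperplane_eq[OF U x(1)]) simp
      have "vec.dim (pencil_kernel A l U) \<le> vec.dim (pencil_kernel A l (hyperplane \<eta> U)) + 1" for l
        using dim_hyperplane_ge[OF subspace_pencil_kernel[OF U], of A l \<eta>]
          vec.dim_subset[OF hyperplane_pencil_kernel_subset[of \<eta> A l U]] by linarith
      then have "{l. vec.dim (pencil_kernel A l (hyperplane \<eta> U)) < k - 1}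
          \<subseteq> {l. vec.dim (pencil_kernel A l U) < k}"
        by (smt (verit) Collect_mono_iff add.commute less_diff_conv order.strict_trans1)
      then have fin': "finite {l. vec.dim (pencil_kernel A l (hyperplane \<eta> U)) < k - 1}"
        using fin finite_subset by blast
      have "\<exists>D. split_form r D \<and> agree_on (hyperplane \<eta> U) A D"
        using dimH dimU by (intro less.hyps[OF _ subspace_hyperplane[OF U] fin']) auto
      then show ?thesis using split_form_extend_radical[OF U _ _ x(1) \<eta> rad] by blast
    qed
  qed
qed

lemma agree_on_UNIV: "agree_on UNIV A D \<Longrightarrow> A = D"
  by (simp add: agree_on_def vec_eq_iff) (metis form_axis)

lemma split_form_of_rank:
  fixes A :: "complex ^ 'n ^ 'n"
  assumes "\<And>l. rank (A - smult_mat l (transpose A)) \<le> r"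
  shows "split_form r A"
proof -
  have smult: "smult_mat l B *v z = l *s (B *v z)" for l z and B :: "complex ^ 'n ^ 'n"
    by (simp add: vec_eq_iff matrix_vector_mult_def smult_mat_def sum_distrib_left mult_ac)
  have "{z. (A - smult_mat l (transpose A)) *v z = 0} \<subseteq> pencil_kernel A l UNIV" for l
  proof
    fix z assume "z \<in> {z. (A - smult_mat l (transpose A)) *v z = 0}"
    then have "A *v z = l *s (transpose A *v z)"
      by (simp add: matrix_vector_mult_diff_rdistrib smult del: transpose_matrix_vector)
    then have "form A y z = l * form (transpose A) y z" for y by (simp add: form_def dot_linear)
    then show "z \<in> pencil_kernel A l UNIV" by (simp add: pencil_kernel_def form_transpose)
  qed
  then have "CARD('n) \<le> vec.dim (pencil_kernel A l UNIV) + r" for l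
    using rank_nullity_ge[of "A - smult_mat l (transpose A)"] assms[of l]
      vec.dim_subset[of _ "pencil_kernel A l UNIV"]
    by (meson add_mono le_trans)
  then have "{l. vec.dim (pencil_kernel A l UNIV) < CARD('n) - r} = {}"
    by (auto simp: not_less le_diff_conv)
  then have "\<exists>D. split_form r D \<and> agree_on UNIV A D"
    by (intro split_form_exists[where k = "CARD('n) - r"]) (auto simp: card_cart_basis)
  then show ?thesis using agree_on_UNIV by blast
qed


section \<open>Back to polynomial matrices\<close>

lemma split_form_sum:
  assumes "split_form r (A :: 'a::field ^ 'n ^ 'n)"
  shows "\<exists>u v a b. A = (if even r then 0 else outer u u)
    + (\<Sum>j = 1..r div 2. outer (v j) (a j)) - (\<Sum>j = 1..r div 2. outer (b j) (v j))"
  using assms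
proof induction
  case (step r D v a b)
  then obtain u vs as bs where D: "D = (if even r then 0 else outer u u)
    + (\<Sum>j = 1..r div 2. outer (vs j) (as j)) - (\<Sum>j = 1..r div 2. outer (bs j) (vs j))"
    by blast
  let ?s = "Suc (r div 2)"
  have "(\<Sum>j = 1..r div 2. outer ((vs(?s := v)) j) ((as(?s := a)) j)) = (\<Sum>j = 1..r div 2. outer (vs j) (as j))"
    "(\<Sum>j = 1..r div 2. outer ((bs(?s := b)) j) ((vs(?s := v)) j)) = (\<Sum>j = 1..r div 2. outer (bs j) (vs j))"
    by (rule sum.cong; simp)+
  then have "D + outer v a - outer b v = (if even (r + 2) then 0 else outer u u)
    + (\<Sum>j = 1..(r + 2) div 2. outer ((vs(?s := v)) j) ((as(?s := a)) j))
    - (\<Sum>j = 1..(r + 2) div 2. outer ((bs(?s := b)) j) ((vs(?s := v)) j))"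
    unfolding D by simp
  then show ?case by blast
qed auto

lemma sum_linear_poly: "(\<Sum>j\<in>S. [:f j, g j:]) = [:\<Sum>j\<in>S. f j, \<Sum>j\<in>S. g j:]"
  for f g :: "'b \<Rightarrow> 'a::comm_monoid_add"
  by (induction S rule: infinite_finite_induct) simp_all

theorem theorem9:
  fixes E :: "complex poly ^ 'n ^ 'n" and r :: nat
  assumes "anti_palindromic E"
    and "normal_rank E = r"
    and "r \<le> CARD('n)"
  shows "\<exists>(u :: complex poly ^ 'n) (v :: nat \<Rightarrow> complex poly ^ 'n) (w :: nat \<Rightarrow> complex poly ^ 'n) (s :: nat).
    s = r div 2 \<and>
    deg_vec u = 0 \<and> (\<forall>j\<in>{1..s}. deg_vec (v j) = 0) \<and> (\<forall>j\<in>{1..s}. deg_vec (w j) \<le> 1) \<and>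
    E = (if even r
         then (\<Sum>j = 1..s. outer (v j) (w j)) - (\<Sum>j = 1..s. outer (rev_vec (w j)) (v j))
         else smult_mat [:1, -1:] (outer u u)
              + (\<Sum>j = 1..s. outer (v j) (w j)) - (\<Sum>j = 1..s. outer (rev_vec (w j)) (v j)))"
proof -
  obtain A where E: "E = pencil A (- transpose A)"
    using assms(1) unfolding anti_palindromic_def by (metis add.inverse_inverse)
  have "rank (A - smult_mat l (transpose A)) \<le> r" for l
  proof -
    have "A - smult_mat l (transpose A) = eval_mat E l"
      by (simp add: E eval_mat_pencil) (simp add: smult_mat_def vec_eq_iff)
    also have "rank \<dots> \<le> r"
      using finite_ranks[of E] assms(2) unfolding normal_rank_def by (metis Max_ge rangeI)
    finally show ?thesis .
  qed
  from split_form_sum[OF split_form_of_rank[OF this]]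
  obtain u v a b where A: "A = (if even r then 0 else outer u u)
    + (\<Sum>j = 1..r div 2. outer (v j) (a j)) - (\<Sum>j = 1..r div 2. outer (b j) (v j))"
    by blast
  define s where "s = r div 2"
  define const :: "complex ^ 'n \<Rightarrow> complex poly ^ 'n" where "const c = (\<chi> i. [:c $ i:])" for c
  define w :: "nat \<Rightarrow> complex poly ^ 'n" where "w j = (\<chi> i. [:a j $ i, b j $ i:])" for j
  have deg_const: "deg_vec (const c) = 0" for c by (auto simp: deg_vec_eq_0_iff const_def)
  have deg_w: "deg_vec (w j) \<le> 1" for j
    unfolding deg_vec_def by (intro Max.boundedI) (auto simp: w_def)
  have entry: "A $ i $ k = (if even r then 0 else u $ i * u $ k)
      + (\<Sum>j = 1..s. v j $ i * a j $ k) - (\<Sum>j = 1..s. b j $ i * v j $ k)" for i k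
    by (subst A) (simp add: outer_def s_def)
  have "E $ i $ k = ((if even r then 0 else smult_mat [:1, -1:] (outer (const u) (const u)))
      + (\<Sum>j = 1..s. outer (const (v j)) (w j)) - (\<Sum>j = 1..s. outer (rev_vec (w j)) (const (v j)))) $ i $ k" for i k
    by (simp add: E pencil_def transpose_def outer_def smult_mat_def const_def w_def rev_vec_linear
        sum_linear_poly entry[of i k] entry[of k i] mult.commute)
  then have "E = (if even r then 0 else smult_mat [:1, -1:] (outer (const u) (const u)))
      + (\<Sum>j = 1..s. outer (const (v j)) (w j)) - (\<Sum>j = 1..s. outer (rev_vec (w j)) (const (v j)))"
    by (simp add: vec_eq_iff)
  then have "E = (if even r
         then (\<Sum>j = 1..s. outer (const (v j)) (w j)) - (\<Sum>j = 1..s. outer (rev_vec (w j)) (const (v j)))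
         else smult_mat [:1, -1:] (outer (const u) (const u))
              + (\<Sum>j = 1..s. outer (const (v j)) (w j)) - (\<Sum>j = 1..s. outer (rev_vec (w j)) (const (v j))))"
    by (cases "even r") simp_all
  with deg_const deg_w s_def show ?thesis
    by (intro exI[of _ "const u"] exI[of _ "\<lambda>j. const (v j)"] exI[of _ w] exI[of _ s]) blast
qed

end
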